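(* Let $G_B$ be the finite support graph of a discrete-time, time-homogeneous Markov chain with transition matrix $Q=(q_{st})$ on a finite state space $S$, and fix an initial state $i\in S$. For each $n\ge 0$ let $a_i(n)$ be the number of distinct occupation vectors of admissible trajectories of length $n$ starting at $i$. Then the generating function \[ A_i(t)=\sum_{n\ge 0}a_i(n)\,t^n \] is rational, i.e. this formal power series is the power series expansion of a quotient of two polynomials in $t$.
   Context: The support graph of $Q$ is the directed graph $G_B=(S,E)$ with $E=\{(s,t)\in S\times S: q_{st}>0\}$ (loops allowed). An admissible trajectory of length $n$ starting at $i$ is a sequence $\gamma=(i_0,i_1,\ldots,i_n)$ of states with $i_0=i$ and $(i_{r},i_{r+1})\in E$ for all $0\le r<n$. It is regarded as the word $w_\gamma=i_0i_1\cdots i_n$ over the alphabet $S$, and $L_i^{(n)}$ denotes the set of all such words for the given $n$. The occupation vector (Parikh vector) of a word $w$ over $S$ is $\Psi(w)=(|w|_s)_{s\in S}\in\mathbb{N}^{S}$, where $|w|_s$ is the number of occurrences of $s$ in $w$. The occupation-pattern growth function is $a_i(n)=\#\{\Psi(w): w\in L_i^{(n)}\}$. *)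

theory Defs
  imports
    "HOL-Library.FuncSet"
    "HOL-Computational_Algebra.Polynomial_FPS"
begin

definition transition_matrix :: "'s set \<Rightarrow> ('s \<Rightarrow> 's \<Rightarrow> real) \<Rightarrow> bool" where
  "transition_matrix S Q \<longleftrightarrow>
     (\<forall>s\<in>S. \<forall>t\<in>S. 0 \<le> Q s t) \<and> (\<forall>s\<in>S. (\<Sum>t\<in>S. Q s t) = 1)"

definition support_edges :: "'s set \<Rightarrow> ('s \<Rightarrow> 's \<Rightarrow> real) \<Rightarrow> ('s \<times> 's) set" where
  "support_edges S Q = {(s, t) \<in> S \<times> S. Q s t > 0}"

(* A trajectory of length n makes n steps, so its word has n + 1 letters. *)
definition trajectory_words ::
    "'s set \<Rightarrow> ('s \<Rightarrow> 's \<Rightarrow> real) \<Rightarrow> 's \<Rightarrow> nat \<Rightarrow> 's list set" where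
  "trajectory_words S Q i n =
     {w. length w = Suc n \<and> set w \<subseteq> S \<and> w ! 0 = i \<and>
         (\<forall>r<n. (w ! r, w ! Suc r) \<in> support_edges S Q)}"

(* The vectors in \<nat>^S are represented as functions extensional on S. *)
definition occupation_vector :: "'s set \<Rightarrow> 's list \<Rightarrow> ('s \<Rightarrow> nat)" where
  "occupation_vector S w = (\<lambda>s\<in>S. count_list w s)"

definition occupation_growth :: "'s set \<Rightarrow> ('s \<Rightarrow> 's \<Rightarrow> real) \<Rightarrow> 's \<Rightarrow> nat \<Rightarrow> nat" where
  "occupation_growth S Q i n = card (occupation_vector S ` trajectory_words S Q i n)"

(* Hence the cardinality above is a genuine count. *)
lemma finite_trajectory_words:
  assumes "finite S"
  shows "finite (trajectory_words S Q i n)"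
  by (rule finite_subset[OF _ finite_lists_length_eq[OF assms, of "Suc n"]])
     (auto simp: trajectory_words_def)

definition occupation_gf :: "'s set \<Rightarrow> ('s \<Rightarrow> 's \<Rightarrow> real) \<Rightarrow> 's \<Rightarrow> rat fps" where
  "occupation_gf S Q i = Abs_fps (\<lambda>n. of_nat (occupation_growth S Q i n))"

(* The denominator must be invertible as a power series: for other denominators,
   division on type fps need not agree with the quotient of the two polynomials. *)
definition rational_fps :: "'a::field fps \<Rightarrow> bool" where
  "rational_fps A \<longleftrightarrow>
     (\<exists>p q. coeff q 0 \<noteq> 0 \<and> A = fps_of_poly p / fps_of_poly q)"

end

theory Submission
  imports Defs "HOL-Library.Multiset"
begin

text \<open>
  The trajectories with a prescribed set \<open>T\<close> of visited states yield a set of occupation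
  vectors that is stable under adding the vector of any simple cycle inside \<open>T\<close>, because such a
  cycle can be inserted where the trajectory meets it. Erasing cycles shows that it lies in
  \<open>F + \<langle>C\<rangle>\<close> with \<open>F\<close> finite and \<open>C\<close> the finite set of these cycle vectors. Rationality then
  follows as in the Hilbert--Serre theorem, by induction on \<open>C\<close>: a stable subset \<open>X\<close> of
  \<open>F + \<langle>C\<rangle>\<close> is finitely generated, say \<open>X = G + \<langle>C\<rangle>\<close>, and for \<open>c \<in> C\<close>, \<open>Y = G + \<langle>C - {c}\<rangle>\<close>
  the series satisfy \<open>(1 - t\<^sup>|\<^sup>c\<^sup>|) H\<^sub>X = H\<^sub>Y - H\<^sub>Z\<close> with \<open>Z = Y \<inter> (X + c)\<close>, where \<open>Y\<close> and \<open>Z\<close> are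
  stable under \<open>C - {c}\<close>.
\<close>

unbundle fps_syntax

section \<open>Rational power series\<close>

text \<open>A nonzero constant coefficient makes \<open>fps_of_poly q\<close> a unit, so
  denominators can be cleared. The closure properties below then need only polynomial
  identities.\<close>

lemma rational_fps_iff:
  "rational_fps A \<longleftrightarrow> (\<exists>p q. coeff q 0 \<noteq> 0 \<and> A * fps_of_poly q = fps_of_poly p)"
proof -
  have "A = fps_of_poly p / fps_of_poly q \<longleftrightarrow> A * fps_of_poly q = fps_of_poly p"
    if "coeff q 0 \<noteq> 0" for p q :: "'a poly"
  proof -
    have inv: "inverse (fps_of_poly q) * fps_of_poly q = 1"
      using that by (intro inverse_mult_eq_1) simp
    have "fps_of_poly p / fps_of_poly q = fps_of_poly p * inverse (fps_of_poly q)"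
      using that by (intro fps_divide_unit) simp
    moreover have "A * fps_of_poly q * inverse (fps_of_poly q) = A"
      using inv by (simp add: mult.assoc mult.commute[of _ "inverse _"])
    moreover have "fps_of_poly p * inverse (fps_of_poly q) * fps_of_poly q = fps_of_poly p"
      using inv by (simp add: mult.assoc)
    ultimately show ?thesis by metis
  qed
  then show ?thesis
    unfolding rational_fps_def by blast
qed

lemma rational_fps_of_poly: "rational_fps (fps_of_poly p)"
  unfolding rational_fps_iff by (rule exI[of _ p], rule exI[of _ 1]) simp

lemma rational_fps_0: "rational_fps 0"
  using rational_fps_of_poly[of 0] by simp

lemma rational_fps_lincomb:
  assumes "rational_fps A" "rational_fps B"
  shows "rational_fps (A + fps_const c * B)"
proof -
  obtain p q p' q' where "coeff q 0 \<noteq> 0" "A * fps_of_poly q = fps_of_poly p"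
    "coeff q' 0 \<noteq> 0" "B * fps_of_poly q' = fps_of_poly p'"
    using assms unfolding rational_fps_iff by blast
  moreover have "(A + fps_const c * B) * (fps_of_poly q * fps_of_poly q') =
      (A * fps_of_poly q) * fps_of_poly q' + fps_const c * ((B * fps_of_poly q') * fps_of_poly q)"
    by (simp add: algebra_simps)
  ultimately have "(A + fps_const c * B) * fps_of_poly (q * q') =
      fps_of_poly (p * q' + smult c (p' * q))" "coeff (q * q') 0 \<noteq> 0"
    by (simp_all add: fps_of_poly_mult fps_of_poly_add fps_of_poly_smult coeff_mult_0)
  then show ?thesis
    unfolding rational_fps_iff by blast
qed

lemma rational_fps_add: "rational_fps A \<Longrightarrow> rational_fps B \<Longrightarrow> rational_fps (A + B)"
  using rational_fps_lincomb[of A B 1] by simp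

lemma rational_fps_diff: "rational_fps A \<Longrightarrow> rational_fps B \<Longrightarrow> rational_fps (A - B)"
  using rational_fps_lincomb[of A B "-1"] by (simp flip: fps_const_neg)

lemma rational_fps_sum: "(\<And>x. x \<in> I \<Longrightarrow> rational_fps (f x)) \<Longrightarrow> rational_fps (\<Sum>x\<in>I. f x)"
  by (induction I rule: infinite_finite_induct) (auto intro: rational_fps_0 rational_fps_add)

text \<open>This solves a linear equation \<open>A * r = B\<close> for \<open>A\<close> within the
  rational series, as the recursion for Hilbert series requires.\<close>

lemma rational_fps_cancel:
  assumes "rational_fps (A * fps_of_poly r)" "coeff r 0 \<noteq> 0"
  shows "rational_fps A"
proof -
  obtain p q where "coeff q 0 \<noteq> 0" "A * fps_of_poly r * fps_of_poly q = fps_of_poly p"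
    using assms(1) unfolding rational_fps_iff by blast
  then have "coeff (r * q) 0 \<noteq> 0" "A * fps_of_poly (r * q) = fps_of_poly p"
    using assms(2) by (auto simp: fps_of_poly_mult mult.assoc coeff_mult_0)
  then show ?thesis
    unfolding rational_fps_iff by blast
qed

section \<open>Finitely generated stable sets of multisets\<close>

definition add_stable :: "'a multiset set \<Rightarrow> 'a multiset set \<Rightarrow> bool" where
  "add_stable C X \<longleftrightarrow> (\<forall>x\<in>X. \<forall>c\<in>C. x + c \<in> X)"

text \<open>The sum of \<open>F\<close> and the submonoid generated by \<open>C\<close>, presented
  as the least superset of \<open>F\<close> that is stable under \<open>C\<close>.\<close>

inductive_set gen :: "'a multiset set \<Rightarrow> 'a multiset set \<Rightarrow> 'a multiset set"
  for C F where
  base: "f \<in> F \<Longrightarrow> f \<in> gen C F"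
| step: "x \<in> gen C F \<Longrightarrow> c \<in> C \<Longrightarrow> x + c \<in> gen C F"

lemma add_stable_gen: "add_stable C (gen C F)"
  by (auto simp: add_stable_def intro: gen.step)

lemma gen_subset:
  assumes "add_stable C X" "F \<subseteq> X"
  shows "gen C F \<subseteq> X"
proof
  fix x assume "x \<in> gen C F"
  then show "x \<in> X"
    by induction (use assms in \<open>auto simp: add_stable_def\<close>)
qed

lemma gen_empty: "gen {} F = F"
proof
  show "gen {} F \<subseteq> F" by (rule gen_subset) (auto simp: add_stable_def)
qed (auto intro: gen.base)

lemma gen_mono: "C \<subseteq> D \<Longrightarrow> gen C F \<subseteq> gen D F"
  by (rule gen_subset) (auto simp: add_stable_def intro: gen.intros)

lemma add_stable_repeat_mset:
  assumes "add_stable C X" "x \<in> X" "c \<in> C"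
  shows "x + repeat_mset k c \<in> X"
proof (induction k)
  case (Suc k)
  then have "(x + repeat_mset k c) + c \<in> X"
    using assms by (auto simp: add_stable_def)
  then show ?case by (simp add: ac_simps)
qed (use assms in simp)

lemma gen_insertE:
  assumes "x \<in> gen (insert c C) F"
  obtains y k where "y \<in> gen C F" "x = y + repeat_mset k c"
proof -
  from assms have "\<exists>y\<in>gen C F. \<exists>k. x = y + repeat_mset k c"
  proof induction
    case (base f)
    then have "f \<in> gen C F" "f = f + repeat_mset 0 c"
      by (auto intro: gen.base)
    then show ?case by blast
  next
    case (step x d)
    then obtain y k where y: "y \<in> gen C F" "x = y + repeat_mset k c" by blast
    show ?case
    proof (cases "d = c")
      case True
      then have "x + d = y + repeat_mset (Suc k) c"
        using y by (simp add: ac_simps)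
      then show ?thesis using y by blast
    next
      case False
      then have "y + d \<in> gen C F"
        using y step by (auto intro: gen.step)
      moreover have "x + d = (y + d) + repeat_mset k c"
        using y by (simp add: ac_simps)
      ultimately show ?thesis by blast
    qed
  qed
  then show thesis using that by blast
qed

text \<open>A noetherian property, proved in the manner of the Hilbert basis theorem. Slice
  \<open>X\<close> by the number \<open>k\<close> of copies of \<open>c\<close> split off. The
  slices \<open>Y k\<close> are stable under \<open>C\<close>, and stability under \<open>c\<close>
  makes them increase with \<open>k\<close>. By induction each slice and their union are finitely
  generated, so the chain becomes constant.\<close>

lemma add_stable_finitely_generated:
  assumes "finite C" "finite F" "X \<subseteq> gen C F" "add_stable C X"
  obtains G where "finite G" "X = gen C G"
proof -
  have "\<exists>G. finite G \<and> X = gen C G"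
    using assms
  proof (induction C arbitrary: F X rule: finite_induct)
    case empty
    then show ?case by (metis gen_empty finite_subset)
  next
    case (insert c C)
    \<comment> \<open>The splitting of an element of \<open>X\<close> need not be unique; slices may
      describe the same element several times, which is harmless.\<close>
    define Y where "Y k = {y \<in> gen C F. y + repeat_mset k c \<in> X}" for k
    have Y_stable: "add_stable C (Y k)" for k
    proof -
      have "(y + d) + repeat_mset k c \<in> X" if "y + repeat_mset k c \<in> X" "d \<in> C" for y d
      proof -
        have "(y + repeat_mset k c) + d \<in> X"
          using that insert.prems(3) by (auto simp: add_stable_def)
        then show ?thesis by (simp add: ac_simps)
      qed
      then show ?thesis
        by (auto simp: add_stable_def Y_def intro: gen.step)
    qed
    have Y_mono: "Y k \<subseteq> Y l" if "k \<le> l" for k l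
    proof
      fix y assume y: "y \<in> Y k"
      then have "(y + repeat_mset k c) + repeat_mset (l - k) c \<in> X"
        using add_stable_repeat_mset[OF insert.prems(3)] by (auto simp: Y_def)
      moreover have "repeat_mset k c + repeat_mset (l - k) c = repeat_mset l c"
        using that by (metis le_add_diff_inverse left_add_mult_distrib_mset repeat_mset_distrib)
      ultimately show "y \<in> Y l"
        using y by (simp add: Y_def add.assoc)
    qed
    have "\<exists>G. finite G \<and> Y k = gen C G" for k
      by (rule insert.IH[OF insert.prems(1) _ Y_stable]) (auto simp: Y_def)
    then obtain G where G: "\<And>k. finite (G k)" "\<And>k. Y k = gen C (G k)"
      by metis
    have "\<exists>U. finite U \<and> (\<Union>k. Y k) = gen C U"
      by (rule insert.IH[OF insert.prems(1)])
        (use Y_stable in \<open>auto simp: Y_def add_stable_def\<close>)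
    then obtain U where U: "finite U" "(\<Union>k. Y k) = gen C U" by blast
    have "\<forall>u\<in>U. \<exists>k. u \<in> Y k"
      using U(2) gen.base by blast
    then obtain h where h: "\<forall>u\<in>U. u \<in> Y (h u)"
      by (rule bchoice[THEN exE])
    \<comment> \<open>Each of the finitely many generators of the union has appeared by stage
      \<open>K\<close>, so no slice exceeds \<open>Y K\<close>. The inserted 0 covers an empty
      \<open>U\<close>.\<close>
    define K where "K = Max (insert 0 (h ` U))"
    have "U \<subseteq> Y K"
    proof
      fix u assume "u \<in> U"
      then have "h u \<le> K" using U(1) by (simp add: K_def)
      then show "u \<in> Y K" using h Y_mono \<open>u \<in> U\<close> by blast
    qed
    then have Y_le: "Y k \<subseteq> Y K" for k
      using gen_subset[OF Y_stable, of U K] U(2) by blast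
    define H where "H = (\<Union>k\<le>K. (\<lambda>g. g + repeat_mset k c) ` G k)"
    have shift: "y + repeat_mset k c \<in> gen (insert c C) H" if "y \<in> Y k" "k \<le> K" for y k
    proof -
      have "y \<in> gen C (G k)" using that G by simp
      then show ?thesis
      proof induction
        case (base f)
        then show ?case using that by (auto simp: H_def intro!: gen.base)
      next
        case (step x d)
        then have "(x + repeat_mset k c) + d \<in> gen (insert c C) H"
          using gen.step[of "x + repeat_mset k c"] by blast
        then show ?case by (simp add: ac_simps)
      qed
    qed
    have "X \<subseteq> gen (insert c C) H"
    proof
      fix x assume "x \<in> X"
      moreover from this obtain y k where y: "y \<in> gen C F" "x = y + repeat_mset k c"
        using insert.prems(2) gen_insertE by blast
      ultimately have "y \<in> Y k" by (auto simp: Y_def)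
      show "x \<in> gen (insert c C) H"
      proof (cases "k \<le> K")
        case True
        then show ?thesis using shift y \<open>y \<in> Y k\<close> by simp
      next
        \<comment> \<open>Past stage \<open>K\<close> the slice brings nothing new: \<open>y\<close>
          already lies in \<open>Y K\<close>, and the remaining \<open>k - K\<close> copies of
          \<open>c\<close> are added by stability.\<close>
        case False
        then have "y + repeat_mset K c \<in> gen (insert c C) H"
          using shift Y_le \<open>y \<in> Y k\<close> by blast
        then have "(y + repeat_mset K c) + repeat_mset (k - K) c \<in> gen (insert c C) H"
          by (rule add_stable_repeat_mset[OF add_stable_gen]) simp
        moreover have "repeat_mset K c + repeat_mset (k - K) c = repeat_mset k c"
          using False by (metis le_add_diff_inverse left_add_mult_distrib_mset
              repeat_mset_distrib nat_le_linear)
        ultimately show ?thesis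
          using y by (simp add: add.assoc)
      qed
    qed
    moreover have "gen (insert c C) H \<subseteq> X"
    proof (rule gen_subset[OF insert.prems(3)])
      have "G k \<subseteq> Y k" for k using G by (auto intro: gen.base)
      then show "H \<subseteq> X" by (fastforce simp: H_def Y_def)
    qed
    moreover have "finite H" using G by (simp add: H_def)
    ultimately show ?case by blast
  qed
  then show thesis using that by blast
qed

section \<open>The Hilbert series of a stable set\<close>

text \<open>This guards the coefficients of \<open>hilbert_series\<close> against the value 0 that
  \<open>card\<close> takes on infinite sets.\<close>

definition locally_finite :: "'a multiset set \<Rightarrow> bool" where
  "locally_finite X \<longleftrightarrow> (\<forall>n. finite {x \<in> X. size x = n})"

definition hilbert_series :: "'a multiset set \<Rightarrow> rat fps" where
  "hilbert_series X = Abs_fps (\<lambda>n. of_nat (card {x \<in> X. size x = n}))"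

lemma locally_finite_subset: "locally_finite Y \<Longrightarrow> X \<subseteq> Y \<Longrightarrow> locally_finite X"
  unfolding locally_finite_def by (fast elim: rev_finite_subset)

lemma locally_finite_multisets:
  assumes "finite S"
  shows "locally_finite {x. set_mset x \<subseteq> S}"
  unfolding locally_finite_def
proof
  fix n
  have "{x \<in> {x. set_mset x \<subseteq> S}. size x = n} \<subseteq> mset ` {xs. set xs \<subseteq> S \<and> length xs = n}"
    (is "_ \<subseteq> ?M")
  proof
    fix x assume x: "x \<in> {x \<in> {x. set_mset x \<subseteq> S}. size x = n}"
    obtain xs where "mset xs = x" using ex_mset by blast
    with x show "x \<in> ?M" by (intro image_eqI[of _ _ xs]) auto
  qed
  then show "finite {x \<in> {x. set_mset x \<subseteq> S}. size x = n}"
    using finite_lists_length_eq[OF assms] by (rule finite_subset[OF _ finite_imageI])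
qed

lemma hilbert_series_Diff:
  assumes "locally_finite X" "Y \<subseteq> X"
  shows "hilbert_series (X - Y) = hilbert_series X - hilbert_series Y"
proof (rule fps_ext)
  fix n
  have fin: "finite {x \<in> X. size x = n}"
    using assms by (simp add: locally_finite_def)
  have sub: "{x \<in> Y. size x = n} \<subseteq> {x \<in> X. size x = n}" using assms by blast
  have "{x \<in> X - Y. size x = n} = {x \<in> X. size x = n} - {x \<in> Y. size x = n}" by blast
  then have "card {x \<in> X - Y. size x = n} = card {x \<in> X. size x = n} - card {x \<in> Y. size x = n}"
    using card_Diff_subset[OF finite_subset[OF sub fin] sub] by simp
  then show "hilbert_series (X - Y) $ n = (hilbert_series X - hilbert_series Y) $ n"
    using card_mono[OF fin sub] by (simp add: hilbert_series_def of_nat_diff)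
qed

lemma hilbert_series_UN:
  assumes "finite I" "\<And>t. t \<in> I \<Longrightarrow> locally_finite (X t)"
    and "\<And>s t. s \<in> I \<Longrightarrow> t \<in> I \<Longrightarrow> s \<noteq> t \<Longrightarrow> X s \<inter> X t = {}"
  shows "hilbert_series (\<Union>t\<in>I. X t) = (\<Sum>t\<in>I. hilbert_series (X t))"
proof (rule fps_ext)
  fix n
  have "{x \<in> (\<Union>t\<in>I. X t). size x = n} = (\<Union>t\<in>I. {x \<in> X t. size x = n})" by blast
  moreover have "card (\<Union>t\<in>I. {x \<in> X t. size x = n}) = (\<Sum>t\<in>I. card {x \<in> X t. size x = n})"
    by (rule card_UN_disjoint) (use assms in \<open>fastforce simp: locally_finite_def\<close>)+
  ultimately show "hilbert_series (\<Union>t\<in>I. X t) $ n = (\<Sum>t\<in>I. hilbert_series (X t)) $ n"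
    by (simp add: hilbert_series_def fps_sum_nth)
qed

lemma hilbert_series_translate:
  "hilbert_series ((\<lambda>x. x + c) ` X) = hilbert_series X * fps_X ^ size c"
proof (rule fps_ext)
  fix n
  show "hilbert_series ((\<lambda>x. x + c) ` X) $ n = (hilbert_series X * fps_X ^ size c) $ n"
  proof (cases "n < size c")
    case True
    then have "{x \<in> (\<lambda>x. x + c) ` X. size x = n} = {}" by auto
    then have "hilbert_series ((\<lambda>x. x + c) ` X) $ n = 0"
      unfolding hilbert_series_def by (simp only: fps_nth_Abs_fps card.empty of_nat_0)
    then show ?thesis
      using True by (simp add: fps_X_power_mult_right_nth)
  next
    case False
    then have "{x \<in> (\<lambda>x. x + c) ` X. size x = n} = (\<lambda>x. x + c) ` {x \<in> X. size x = n - size c}"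
      by auto
    then have "card {x \<in> (\<lambda>x. x + c) ` X. size x = n} = card {x \<in> X. size x = n - size c}"
      by (simp only:) (rule card_image, simp add: inj_on_def)
    then show ?thesis
      using False by (simp add: hilbert_series_def fps_X_power_mult_right_nth)
  qed
qed

lemma rational_hilbert_series_finite:
  assumes "finite X"
  shows "rational_fps (hilbert_series X)"
proof -
  have "X = (\<Union>x\<in>X. {x})" by blast
  moreover have "hilbert_series (\<Union>x\<in>X. {x}) = (\<Sum>x\<in>X. hilbert_series {x})"
    using assms by (intro hilbert_series_UN) (auto simp: locally_finite_def)
  moreover have "hilbert_series {x} = fps_of_poly (monom 1 (size x))" for x :: "'a multiset"
  proof (rule fps_ext)
    fix n
    have "{y \<in> {x}. size y = n} = (if size x = n then {x} else {})" by auto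
    then have "card {y \<in> {x}. size y = n} = (if size x = n then 1 else 0)" by simp
    then show "hilbert_series {x} $ n = fps_of_poly (monom 1 (size x)) $ n"
      unfolding hilbert_series_def by simp
  qed
  ultimately show ?thesis
    by (simp add: rational_fps_sum rational_fps_of_poly)
qed

theorem rational_hilbert_series:
  assumes "finite C" "{#} \<notin> C" "finite F" "X \<subseteq> gen C F" "add_stable C X" "locally_finite X"
  shows "rational_fps (hilbert_series X)"
  using assms
proof (induction C arbitrary: F X rule: finite_induct)
  case empty
  then show ?case
    by (metis gen_empty finite_subset rational_hilbert_series_finite)
next
  case (insert c C)
  \<comment> \<open>Exact generators are needed here: \<open>gen C F\<close> may leave
    \<open>X\<close>, whereas \<open>gen C G\<close> is contained in it.\<close>
  obtain G where G: "finite G" "X = gen (insert c C) G"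
    by (rule add_stable_finitely_generated[of "insert c C" F X]) (use insert in auto)
  define Xc where "Xc = (\<lambda>x. x + c) ` X"
  define Y where "Y = gen C G"
  have "Xc \<subseteq> X"
    using insert.prems(4) by (auto simp: Xc_def add_stable_def)
  have "Y \<subseteq> X"
    unfolding Y_def G by (rule gen_mono) auto
  \<comment> \<open>An element outside \<open>Y\<close> must use \<open>c\<close> at least once, and
    removing one copy stays in \<open>X\<close>.\<close>
  have "X - Y \<subseteq> Xc"
  proof
    fix x assume x: "x \<in> X - Y"
    then obtain y k where y: "y \<in> gen C G" "x = y + repeat_mset k c"
      using G gen_insertE by blast
    with x obtain l where "k = Suc l"
      by (cases k) (auto simp: Y_def)
    then have "x = (y + repeat_mset l c) + c" using y by (simp add: ac_simps)
    moreover have "y + repeat_mset l c \<in> X"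
      using y \<open>Y \<subseteq> X\<close> add_stable_repeat_mset[OF insert.prems(4)] by (auto simp: Y_def)
    ultimately show "x \<in> Xc" by (auto simp: Xc_def)
  qed
  then have *: "X - Xc = Y - Y \<inter> Xc" using \<open>Y \<subseteq> X\<close> by blast
  have "add_stable C Xc"
    unfolding add_stable_def Xc_def
  proof (intro ballI)
    fix x d assume "x \<in> (\<lambda>x. x + c) ` X" "d \<in> C"
    then obtain y where "x = y + c" "y + d \<in> X"
      using insert.prems(4) by (auto simp: add_stable_def)
    then show "x + d \<in> (\<lambda>x. x + c) ` X"
      by (intro image_eqI[of _ _ "y + d"]) (auto simp: ac_simps)
  qed
  then have "add_stable C (Y \<inter> Xc)"
    using add_stable_gen[of C G] by (auto simp: add_stable_def Y_def)
  have lf: "locally_finite Y"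
    using insert.prems(5) \<open>Y \<subseteq> X\<close> by (rule locally_finite_subset)
  have "rational_fps (hilbert_series Y)"
    by (rule insert.IH[of G]) (use insert.prems G lf in \<open>auto simp: Y_def add_stable_gen\<close>)
  moreover have "rational_fps (hilbert_series (Y \<inter> Xc))"
    by (rule insert.IH[of G])
      (use insert.prems G locally_finite_subset[OF lf] \<open>add_stable C (Y \<inter> Xc)\<close> in \<open>auto simp: Y_def\<close>)
  ultimately have "rational_fps (hilbert_series (Y - Y \<inter> Xc))"
    using lf by (simp add: hilbert_series_Diff rational_fps_diff)
  then have "rational_fps (hilbert_series X - hilbert_series Xc)"
    using * hilbert_series_Diff[OF insert.prems(5) \<open>Xc \<subseteq> X\<close>] by simp
  moreover have "hilbert_series X - hilbert_series Xc =
      hilbert_series X * fps_of_poly (1 - monom 1 (size c))"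
    by (simp add: Xc_def hilbert_series_translate fps_of_poly_diff fps_of_poly_monom'
        algebra_simps)
  \<comment> \<open>Since \<open>c\<close> is not the empty multiset, \<open>size c\<close> is
    positive and the constant coefficient is 1.\<close>
  moreover have "coeff (1 - monom 1 (size c) :: rat poly) 0 \<noteq> 0"
    using insert.prems(1) by auto
  ultimately show ?case
    by (metis rational_fps_cancel)
qed

section \<open>Walks in a finite graph\<close>

definition walk :: "('s \<times> 's) set \<Rightarrow> 's list \<Rightarrow> bool" where
  "walk E w \<longleftrightarrow> successively (\<lambda>s t. (s, t) \<in> E) w"

text \<open>The base point of a closed walk is recorded only once, as the last letter.\<close>

definition cycle_vectors :: "('s \<times> 's) set \<Rightarrow> 's set \<Rightarrow> 's multiset set" where
  "cycle_vectors E T = {mset (u @ [a]) | u a. distinct (u @ [a]) \<and> set (u @ [a]) \<subseteq> T \<and>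
     walk E (a # u @ [a])}"

text \<open>The initial state is left out, so that the size of the multiset is the number of steps.\<close>

definition walk_vectors :: "('s \<times> 's) set \<Rightarrow> 's \<Rightarrow> 's set \<Rightarrow> 's multiset set" where
  "walk_vectors E i T = {mset v | v. walk E (i # v) \<and> set (i # v) = T}"

lemma finite_mset_distinct:
  assumes "finite T"
  shows "finite {mset u | u. distinct u \<and> set u \<subseteq> T}"
proof -
  have "{mset u | u. distinct u \<and> set u \<subseteq> T} = mset ` {u. set u \<subseteq> T \<and> distinct u}"
    by auto
  then show ?thesis
    using finite_subset_distinct[OF assms] by simp
qed

lemma finite_cycle_vectors: "finite T \<Longrightarrow> finite (cycle_vectors E T)"
  by (rule finite_subset[OF _ finite_mset_distinct]) (unfold cycle_vectors_def, blast)

lemma walk_append_insert_cycle: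
  assumes "walk E (p @ a # q)" "walk E (a # u @ [a])"
  shows "walk E (p @ a # u @ a # q)"
  using assms unfolding walk_def
  by (auto simp: successively_append_iff successively_Cons hd_append split: if_splits)

text \<open>Prescribing the visited set exactly is what makes this work: the walk meets the base
  point of every cycle inside \<open>T\<close>, and the detour visits no state outside
  \<open>T\<close>.\<close>

lemma add_stable_walk_vectors: "add_stable (cycle_vectors E T) (walk_vectors E i T)"
  unfolding add_stable_def
proof (intro ballI)
  fix x c assume "x \<in> walk_vectors E i T" "c \<in> cycle_vectors E T"
  then obtain v u a where v: "x = mset v" "walk E (i # v)" "set (i # v) = T"
    and u: "c = mset (u @ [a])" "set (u @ [a]) \<subseteq> T" "walk E (a # u @ [a])"
    unfolding walk_vectors_def cycle_vectors_def by blast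
  then have "a \<in> set (i # v)" by auto
  then obtain p q where pq: "i # v = p @ a # q" by (meson split_list)
  define w where "w = p @ a # u @ a # q"
  have w: "walk E w" "set w = T" "mset w = add_mset i (x + c)"
  proof -
    show "walk E w"
      using walk_append_insert_cycle v(2) u(3) unfolding w_def pq by metis
    have "set w = set (p @ a # q) \<union> set (u @ [a])" by (auto simp: w_def)
    then show "set w = T" using u(2) v(3) pq by auto
    have "mset w = mset (p @ a # q) + mset (u @ [a])" by (simp add: w_def)
    then show "mset w = add_mset i (x + c)" using v(1) u(1) pq[symmetric] by simp
  qed
  \<comment> \<open>If \<open>p\<close> is empty then \<open>a = i\<close>, so the longer walk
    starts at \<open>i\<close> in either case.\<close>
  have "hd w = i" "w \<noteq> []" using pq by (auto simp: w_def hd_append Cons_eq_append_conv)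
  then have "w = i # tl w" by (metis list.collapse)
  moreover from this have "mset (tl w) = x + c"
    using w(3) by (metis add_mset_add_mset_same_iff mset.simps(2))
  ultimately show "x + c \<in> walk_vectors E i T"
    using w unfolding walk_vectors_def by (smt (verit) mem_Collect_eq)
qed

text \<open>A translation commutes with adding elements of \<open>C\<close>, so only the elements of
  \<open>F\<close> have to be checked.\<close>

lemma gen_add_left:
  assumes "x \<in> gen C F" "\<And>f. f \<in> F \<Longrightarrow> z + f \<in> gen C H"
  shows "z + x \<in> gen C H"
  using assms(1)
proof induction
  case (step x c)
  then show ?case by (metis add.assoc gen.step)
qed (use assms in auto)

text \<open>Loop erasure from the end of the walk. Once the tail is reduced to a self-avoiding walk,
  prepending a letter either keeps it self-avoiding or closes one simple cycle, which is split off
  as a generator.\<close>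

lemma mset_walk_in_gen:
  assumes "walk E (a # v)" "set (a # v) \<subseteq> T"
  shows "mset v \<in> gen (cycle_vectors E T)
    {mset p | p. walk E (a # p) \<and> distinct (a # p) \<and> set (a # p) \<subseteq> T}"
  using assms
proof (induction v arbitrary: a)
  case Nil
  then show ?case
    by (intro gen.base CollectI exI[of _ "[]"]) auto
next
  case (Cons b v)
  let ?F = "\<lambda>a. {mset p | p. walk E (a # p) \<and> distinct (a # p) \<and> set (a # p) \<subseteq> T}"
  have ab: "(a, b) \<in> E" "walk E (b # v)"
    using Cons.prems by (auto simp: walk_def)
  have "{#b#} + mset v \<in> gen (cycle_vectors E T) (?F a)"
  proof (rule gen_add_left)
    show "mset v \<in> gen (cycle_vectors E T) (?F b)"
      using Cons ab by auto
  next
    fix f assume "f \<in> ?F b"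
    then obtain p where p: "f = mset p" "walk E (b # p)" "distinct (b # p)" "set (b # p) \<subseteq> T"
      by blast
    then have walk: "walk E (a # b # p)" using ab by (simp add: walk_def)
    show "{#b#} + f \<in> gen (cycle_vectors E T) (?F a)"
    proof (cases "a \<in> set (b # p)")
      case False
      then show ?thesis
        using p walk Cons.prems by (intro gen.base CollectI exI[of _ "b # p"]) auto
    next
      case True
      \<comment> \<open>The first return to \<open>a\<close> cuts the walk into the simple cycle
        \<open>a # u @ [a]\<close> and the self-avoiding rest \<open>a # q\<close>. An empty
        \<open>u\<close> gives a loop at \<open>a\<close>.\<close>
      then obtain u q where uq: "b # p = u @ a # q" by (meson split_list)
      then have "distinct (u @ a # q)" "set (u @ a # q) \<subseteq> T" "walk E ((a # u) @ a # q)"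
        using p walk by auto
      then have "distinct (u @ [a])" "set (u @ [a]) \<subseteq> T" "walk E (a # u @ [a])"
        and "distinct (a # q)" "set (a # q) \<subseteq> T" "walk E (a # q)"
        unfolding walk_def
        by (auto simp: successively_append_iff successively_Cons hd_append split: if_splits)
      then have "mset (u @ [a]) \<in> cycle_vectors E T" "mset q \<in> ?F a"
        unfolding cycle_vectors_def by blast+
      then have "mset q + mset (u @ [a]) \<in> gen (cycle_vectors E T) (?F a)"
        by (intro gen.step gen.base)
      moreover have "{#b#} + f = mset (b # p)" using p by simp
      ultimately show ?thesis unfolding uq by (simp add: ac_simps)
    qed
  qed
  then show ?case by simp
qed

lemma rational_walk_vectors:
  assumes "finite T"
  shows "rational_fps (hilbert_series (walk_vectors E i T))"
proof (rule rational_hilbert_series)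
  show "finite (cycle_vectors E T)" using assms by (rule finite_cycle_vectors)
  show "{#} \<notin> cycle_vectors E T" by (auto simp: cycle_vectors_def)
  show "finite {mset p | p. walk E (i # p) \<and> distinct (i # p) \<and> set (i # p) \<subseteq> T}"
    by (rule finite_subset[OF _ finite_mset_distinct[OF assms]]) auto
  show "walk_vectors E i T \<subseteq> gen (cycle_vectors E T)
      {mset p | p. walk E (i # p) \<and> distinct (i # p) \<and> set (i # p) \<subseteq> T}"
    unfolding walk_vectors_def using mset_walk_in_gen[of E i _ T] by blast
  show "add_stable (cycle_vectors E T) (walk_vectors E i T)" by (rule add_stable_walk_vectors)
  show "locally_finite (walk_vectors E i T)"
    by (rule locally_finite_subset[OF locally_finite_multisets[OF assms]])
      (auto simp: walk_vectors_def)
qed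

section \<open>From occupation vectors of trajectories to multisets\<close>

lemma trajectory_words_eq:
  assumes "i \<in> S"
  shows "trajectory_words S Q i n =
    (#) i ` {v. length v = n \<and> walk (support_edges S Q) (i # v) \<and> set v \<subseteq> S}"
proof (intro set_eqI iffI)
  fix w assume "w \<in> trajectory_words S Q i n"
  moreover from this obtain v where "w = i # v"
    by (cases w) (auto simp: trajectory_words_def)
  ultimately show
    "w \<in> (#) i ` {v. length v = n \<and> walk (support_edges S Q) (i # v) \<and> set v \<subseteq> S}"
    by (auto simp: trajectory_words_def walk_def successively_conv_nth)
next
  fix w assume "w \<in> (#) i ` {v. length v = n \<and> walk (support_edges S Q) (i # v) \<and> set v \<subseteq> S}"
  then show "w \<in> trajectory_words S Q i n"
    using assms by (auto simp: trajectory_words_def walk_def successively_conv_nth)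
qed

lemma occupation_growth_eq:
  assumes "i \<in> S"
  shows "occupation_growth S Q i n =
    card {x \<in> (\<Union>T\<in>Pow S. walk_vectors (support_edges S Q) i T). size x = n}"
proof -
  let ?V = "{v. length v = n \<and> walk (support_edges S Q) (i # v) \<and> set v \<subseteq> S}"
  let ?f = "\<lambda>x. \<lambda>s\<in>S. count (add_mset i x) s"
  have "occupation_vector S (i # v) = ?f (mset v)" for v
    by (auto simp: occupation_vector_def count_mset fun_eq_iff restrict_def)
  then have "occupation_vector S ` trajectory_words S Q i n = ?f ` mset ` ?V"
    unfolding trajectory_words_eq[OF assms] image_image by (simp only:)
  \<comment> \<open>Neither adding \<open>i\<close> nor restricting to \<open>S\<close> loses
    information, because all letters lie in \<open>S\<close> and counts elsewhere vanish.\<close>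
  moreover have "inj_on ?f (mset ` ?V)"
  proof (rule inj_onI)
    fix x y assume xy: "x \<in> mset ` ?V" "y \<in> mset ` ?V" "?f x = ?f y"
    show "x = y"
    proof (rule multiset_eqI)
      fix s
      show "count x s = count y s"
      proof (cases "s \<in> S")
        case True
        then show ?thesis
          using fun_cong[OF xy(3), of s] by (auto split: if_splits)
      next
        case False
        then have "s \<notin># x" "s \<notin># y" using xy by auto
        then show ?thesis by (simp add: not_in_iff)
      qed
    qed
  qed
  moreover have "mset ` ?V =
      {x \<in> (\<Union>T\<in>Pow S. walk_vectors (support_edges S Q) i T). size x = n}"
    using assms by (auto simp: walk_vectors_def)
  ultimately show ?thesis
    by (simp add: occupation_growth_def card_image)
qed

theorem proposition5p4:
  fixes S :: "'s set" and Q :: "'s \<Rightarrow> 's \<Rightarrow> real" and i :: 's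
  assumes "finite S"
    and "transition_matrix S Q"
    and "i \<in> S"
  shows "rational_fps (occupation_gf S Q i)"
proof -
  let ?X = "walk_vectors (support_edges S Q) i"
  \<comment> \<open>The vector determines the visited set once the omitted initial state is
    restored, so different \<open>T\<close> give disjoint sets and their series add up.\<close>
  have support: "T = insert i (set_mset x)" if "x \<in> ?X T" for x T
    using that by (auto simp: walk_vectors_def)
  have "occupation_gf S Q i = hilbert_series (\<Union>T\<in>Pow S. ?X T)"
    unfolding occupation_gf_def hilbert_series_def occupation_growth_eq[OF assms(3)] ..
  also have "\<dots> = (\<Sum>T\<in>Pow S. hilbert_series (?X T))"
  proof (rule hilbert_series_UN)
    show "finite (Pow S)" using assms(1) by simp
    show "locally_finite (?X T)" if "T \<in> Pow S" for T
      by (rule locally_finite_subset[OF locally_finite_multisets[OF assms(1)]])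
        (use that in \<open>auto simp: walk_vectors_def\<close>)
    show "?X T \<inter> ?X T' = {}" if "T \<noteq> T'" for T T'
      using that support by blast
  qed
  also have "rational_fps \<dots>"
    using assms(1) by (intro rational_fps_sum rational_walk_vectors) (auto intro: finite_subset)
  finally show ?thesis .
qed

end
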